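(* Let $M$ be a complete pointed metric space and let $\{K_i : i\in I\}$ be a family of closed subsets of $M$. Then $$\bigcap_{i\in I}\mathcal{F}_M(K_i)=\mathcal{F}_M\Big(\bigcap_{i\in I}K_i\Big).$$
   Context: A pointed metric space $(M,d)$ has a distinguished base point $0\in M$. $\mathrm{Lip}_0(M)$ is the Banach space of all real-valued Lipschitz functions $f$ on $M$ with $f(0)=0$, normed by the Lipschitz constant $\|f\|_L$. For $x\in M$, $\delta(x)\in\mathrm{Lip}_0(M)^*$ is the evaluation functional $f\mapsto f(x)$. The Lipschitz-free space is $\mathcal{F}(M)=\overline{\mathrm{span}}\,\{\delta(x):x\in M\}\subset \mathrm{Lip}_0(M)^*$ (norm closure). For $K\subset M$, $\mathcal{F}_M(K)=\overline{\mathrm{span}}\,\{\delta(x):x\in K\}\subset\mathcal{F}(M)$, with the convention $\mathrm{span}\,\varnothing=\{0\}$ (so $\mathcal{F}_M(\varnothing)=\{0\}$). The sets $K_i$ are not required to contain the base point. *)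

theory Defs
  imports "HOL-Analysis.Analysis"
begin

class pointed_metric_space = metric_space +
  fixes base_point :: 'a

typedef (overloaded) 'a lip0 =
  "{f :: 'a::pointed_metric_space \<Rightarrow> real. (\<exists>L. L-lipschitz_on UNIV f) \<and> f base_point = 0}"
  morphisms lip0_apply Lip0
  by (rule exI[where x = "\<lambda>_. 0"]) (auto intro: lipschitz_on_constant)

setup_lifting type_definition_lip0

lemma lip0_apply_base [simp]: "lip0_apply f base_point = 0"
  using lip0_apply[of f] by simp

lemma lip0_apply_lipschitz: "\<exists>L. L-lipschitz_on UNIV (lip0_apply f)"
  using lip0_apply[of f] by simp

lemma lip0_eqI: "(\<And>x. lip0_apply f x = lip0_apply g x) \<Longrightarrow> f = g"
  by (simp add: lip0_apply_inject[symmetric] fun_eq_iff)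

instantiation lip0 :: (pointed_metric_space) real_vector
begin

lift_definition zero_lip0 :: "'a lip0" is "\<lambda>_. 0"
  by (auto intro: lipschitz_on_constant)

lift_definition plus_lip0 :: "'a lip0 \<Rightarrow> 'a lip0 \<Rightarrow> 'a lip0" is "\<lambda>f g x. f x + g x"
  by (auto intro: lipschitz_on_add)

lift_definition minus_lip0 :: "'a lip0 \<Rightarrow> 'a lip0 \<Rightarrow> 'a lip0" is "\<lambda>f g x. f x - g x"
  by (auto intro: lipschitz_on_diff)

lift_definition uminus_lip0 :: "'a lip0 \<Rightarrow> 'a lip0" is "\<lambda>f x. - f x"
  by (auto intro: lipschitz_on_minus)

lift_definition scaleR_lip0 :: "real \<Rightarrow> 'a lip0 \<Rightarrow> 'a lip0" is "\<lambda>c f x. c * f x"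
  by (auto intro: lipschitz_on_cmult_real)

instance
  by standard (transfer; simp add: algebra_simps fun_eq_iff)+

end

lemmas lip0_apply_simps [simp] =
  zero_lip0.rep_eq plus_lip0.rep_eq minus_lip0.rep_eq uminus_lip0.rep_eq scaleR_lip0.rep_eq

text \<open>The norm is the least Lipschitz constant. Taking an infimum of Lipschitz constants
  rather than a supremum of difference quotients keeps the one-point space, where there are no
  difference quotients, from being a special case.\<close>

definition lipschitz_constant :: "('a::metric_space \<Rightarrow> real) \<Rightarrow> real"
  where "lipschitz_constant f = Inf {L. L-lipschitz_on UNIV f}"

lemma lipschitz_constant_le: "L-lipschitz_on UNIV f \<Longrightarrow> lipschitz_constant f \<le> L"
  unfolding lipschitz_constant_def
  by (rule cInf_lower) (auto intro!: bdd_belowI[of _ 0] lipschitz_on_nonneg)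

lemma lipschitz_on_lipschitz_constant:
  assumes "\<exists>L. L-lipschitz_on UNIV f"
  shows "(lipschitz_constant f)-lipschitz_on UNIV f"
proof (rule lipschitz_onI)
  let ?S = "{L. L-lipschitz_on UNIV f}"
  have ne: "?S \<noteq> {}" using assms by auto
  show "0 \<le> lipschitz_constant f"
    unfolding lipschitz_constant_def
    by (rule cInf_greatest[OF ne]) (auto intro: lipschitz_on_nonneg)
  fix x y
  show "dist (f x) (f y) \<le> lipschitz_constant f * dist x y"
  proof (cases "x = y")
    case False
    then have d: "dist x y > 0" by simp
    have "dist (f x) (f y) / dist x y \<le> lipschitz_constant f"
      unfolding lipschitz_constant_def
    proof (rule cInf_greatest[OF ne])
      fix L assume "L \<in> ?S"
      then have "dist (f x) (f y) \<le> L * dist x y" by (auto intro: lipschitz_onD)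
      then show "dist (f x) (f y) / dist x y \<le> L" using d by (simp add: divide_le_eq)
    qed
    then show ?thesis using d by (simp add: divide_le_eq)
  qed simp
qed

instantiation lip0 :: (pointed_metric_space) real_normed_vector
begin

definition norm_lip0 :: "'a lip0 \<Rightarrow> real"
  where "norm_lip0 f = lipschitz_constant (lip0_apply f)"

definition dist_lip0 :: "'a lip0 \<Rightarrow> 'a lip0 \<Rightarrow> real"
  where "dist_lip0 f g = norm (f - g)"

definition sgn_lip0 :: "'a lip0 \<Rightarrow> 'a lip0"
  where "sgn_lip0 f = f /\<^sub>R norm f"

definition uniformity_lip0 :: "('a lip0 \<times> 'a lip0) filter"
  where "uniformity_lip0 = (INF e\<in>{0 <..}. principal {(f, g). dist f g < e})"

definition open_lip0 :: "'a lip0 set \<Rightarrow> bool"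
  where "open_lip0 U \<longleftrightarrow> (\<forall>f\<in>U. \<forall>\<^sub>F (f', g) in uniformity. f' = f \<longrightarrow> g \<in> U)"

instance
proof
  have lip: "(norm f)-lipschitz_on UNIV (lip0_apply f)" for f :: "'a lip0"
    unfolding norm_lip0_def by (rule lipschitz_on_lipschitz_constant[OF lip0_apply_lipschitz])
  have le: "norm f \<le> L" if "L-lipschitz_on UNIV (lip0_apply f)" for f :: "'a lip0" and L
    unfolding norm_lip0_def using that by (rule lipschitz_constant_le)
  have nonneg: "0 \<le> norm f" for f :: "'a lip0"
    using lip by (rule lipschitz_on_nonneg)
  fix f g :: "'a lip0" and a :: real
  show "norm f = 0 \<longleftrightarrow> f = 0"
  proof
    assume "norm f = 0"
    then have "dist (lip0_apply f x) (lip0_apply f base_point) \<le> 0" for x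
      using lipschitz_onD[OF lip, of x base_point f] by simp
    then show "f = 0" by (auto intro: lip0_eqI)
  next
    assume "f = 0"
    moreover have "norm (0 :: 'a lip0) \<le> 0"
      by (rule le) (simp add: lipschitz_on_constant)
    ultimately show "norm f = 0" using nonneg[of f] by simp
  qed
  show "norm (f + g) \<le> norm f + norm g"
    by (rule le) (simp add: lipschitz_on_add[OF lip lip])
  have scale_le: "norm (c *\<^sub>R h) \<le> \<bar>c\<bar> * norm h" for c and h :: "'a lip0"
    by (rule le) (simp add: lipschitz_on_cmult_real[OF lip])
  show "norm (a *\<^sub>R f) = \<bar>a\<bar> * norm f"
  proof (cases "a = 0")
    case True
    then show ?thesis using scale_le[of 0 f] nonneg[of "0 *\<^sub>R f"] by simp
  next
    case False
    have "norm f \<le> \<bar>inverse a\<bar> * norm (a *\<^sub>R f)"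
      using scale_le[of "inverse a" "a *\<^sub>R f"] False by simp
    then have "\<bar>a\<bar> * norm f \<le> \<bar>a\<bar> * (\<bar>inverse a\<bar> * norm (a *\<^sub>R f))"
      by (rule mult_left_mono) simp
    also have "\<dots> = norm (a *\<^sub>R f)"
      using False by (simp add: abs_mult[symmetric] mult.assoc[symmetric])
    finally show ?thesis using scale_le[of a f] by simp
  qed
qed (simp_all add: dist_lip0_def sgn_lip0_def uniformity_lip0_def open_lip0_def)

end

lemma lip0_lipschitz_norm: "(norm f)-lipschitz_on UNIV (lip0_apply f)"
  unfolding norm_lip0_def by (rule lipschitz_on_lipschitz_constant[OF lip0_apply_lipschitz])

lift_definition delta :: "'a::pointed_metric_space \<Rightarrow> 'a lip0 \<Rightarrow>\<^sub>L real"
  is "\<lambda>x f. lip0_apply f x"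
proof (rule bounded_linear_intro)
  fix x :: 'a and f :: "'a lip0"
  show "norm (lip0_apply f x) \<le> norm f * dist x base_point"
    using lipschitz_onD[OF lip0_lipschitz_norm, of x base_point f] by (simp add: dist_norm)
qed simp_all

text \<open>The space over a subset \<open>K\<close> is formed inside the dual of \<open>Lip\<^sub>0\<close> of the whole space.
  The set \<open>K\<close> need not contain the base point, and \<open>K = {}\<close> gives \<open>{0}\<close>.\<close>

definition free_space_on :: "'a::pointed_metric_space set \<Rightarrow> ('a lip0 \<Rightarrow>\<^sub>L real) set"
  where "free_space_on K = closure (span (delta ` K))"

text \<open>An intersection over an empty index set is \<open>UNIV\<close>, here the whole dual of \<open>Lip\<^sub>0\<close>. Intersections
  of subspaces \<open>free_space_on K\<close> are to be taken within the following ambient space.\<close>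

abbreviation free_space :: "('a::pointed_metric_space lip0 \<Rightarrow>\<^sub>L real) set"
  where "free_space \<equiv> free_space_on UNIV"

lemma free_space_on_empty: "free_space_on {} = {0}"
  by (simp add: free_space_on_def)

lemma free_space_on_subset: "free_space_on K \<subseteq> free_space"
  unfolding free_space_on_def by (intro closure_mono span_mono) auto

end

theory Submission
  imports Defs
begin

text \<open>
  Let \<open>m\<close> lie in every \<open>free_space_on (K i)\<close> and let \<open>f\<close> vanish on \<open>\<Inter>i. K i\<close>; by Hahn-Banach it
  suffices that \<open>m f = 0\<close>. Since \<open>m\<close> is a norm limit of finite combinations of evaluations, \<open>f\<close> may be
  changed off a finite set at bounded cost in the Lipschitz constant, so \<open>f\<close> may be taken
  bounded and zero near \<open>\<Inter>i. K i\<close>. If \<open>m f \<noteq> 0\<close>,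
  multiplying \<open>f\<close> by a \<open>1/r\<close>-Lipschitz cutoff equal to 1 on a large finite set barely changes \<open>m f\<close>,
  and splitting the cutoff into pieces supported in \<open>r\<close>-balls yields a piece on which \<open>m\<close> is
  still nonzero. Iterating with \<open>r \<rightarrow> 0\<close>, completeness gives a point \<open>x\<close> such that \<open>m\<close> is nonzero on
  functions supported arbitrarily close to \<open>x\<close> and inside the support of \<open>f\<close>. The first
  property forces \<open>x \<in> K i\<close> for all \<open>i\<close>, the second \<open>x \<notin> \<Inter>i. K i\<close>.
\<close>

section \<open>Hahn-Banach separation by minimal sublinear functionals\<close>

definition sublinear :: "('v::real_vector \<Rightarrow> real) \<Rightarrow> bool"
  where "sublinear p \<longleftrightarrow>
    (\<forall>u v. p (u + v) \<le> p u + p v) \<and> (\<forall>c v. c > 0 \<longrightarrow> p (c *\<^sub>R v) = c * p v) \<and> p 0 = 0"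

text \<open>An upper bound under positive scaling suffices: applied to \<open>inverse c\<close> it
  gives the reverse inequality. This suits functionals defined as infima, for which upper bounds
  come from approximate minimisers.\<close>

lemma sublinearI:
  assumes "\<And>u v. p (u + v) \<le> p u + p v"
    and "\<And>c v. c > 0 \<Longrightarrow> p (c *\<^sub>R v) \<le> c * p v"
    and "p 0 = 0"
  shows "sublinear p"
proof -
  have "p (c *\<^sub>R v) = c * p v" if "c > 0" for c v
  proof (rule antisym)
    have "p (inverse c *\<^sub>R (c *\<^sub>R v)) \<le> inverse c * p (c *\<^sub>R v)"
      using that by (intro assms(2)) simp
    then show "c * p v \<le> p (c *\<^sub>R v)"
      using that by (simp add: field_simps)
  qed (use assms(2) that in blast)
  then show ?thesis
    using assms unfolding sublinear_def by blast
qed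

lemma sublinear_add: "sublinear p \<Longrightarrow> p (u + v) \<le> p u + p v"
  and sublinear_scaleR: "sublinear p \<Longrightarrow> c > 0 \<Longrightarrow> p (c *\<^sub>R v) = c * p v"
  and sublinear_0: "sublinear p \<Longrightarrow> p 0 = 0"
  unfolding sublinear_def by auto

lemma sublinear_minus_ge: "sublinear p \<Longrightarrow> - p (- v) \<le> p v"
  using sublinear_add[of p v "- v"] by (simp add: sublinear_0)

text \<open>A minimal sublinear functional equals all its tilts, which forces it to be linear.\<close>

definition sublinear_tilt :: "('v::real_vector \<Rightarrow> real) \<Rightarrow> 'v \<Rightarrow> 'v \<Rightarrow> real"
  where "sublinear_tilt p y v = (INF t\<in>{0..}. p (v + t *\<^sub>R y) - t * p y)"

lemma sublinear_tilt_le: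
  assumes p: "sublinear p" and "t \<ge> 0"
  shows "sublinear_tilt p y v \<le> p (v + t *\<^sub>R y) - t * p y"
  unfolding sublinear_tilt_def
proof (rule cINF_lower)
  \<comment> \<open>A real infimum is meaningful only when bounded below. Subadditivity for
    \<open>t *\<^sub>R y\<close>, written as \<open>(v + t *\<^sub>R y) + (- v)\<close>, gives the
    bound \<open>- p (- v)\<close>, uniform in \<open>t\<close>.\<close>
  show "bdd_below ((\<lambda>t. p (v + t *\<^sub>R y) - t * p y) ` {0..})"
  proof (rule bdd_belowI2[of _ "- p (- v)"])
    fix t :: real
    assume "t \<in> {0..}"
    then have "p (t *\<^sub>R y) = t * p y"
      using sublinear_scaleR[OF p, of t y] sublinear_0[OF p] by (cases "t = 0") auto
    then show "- p (- v) \<le> p (v + t *\<^sub>R y) - t * p y"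
      using sublinear_add[OF p, of "v + t *\<^sub>R y" "- v"] by simp
  qed
qed (use assms in auto)

text \<open>Approximately minimising parameters combine: \<open>s\<close> for \<open>u\<close> and
  \<open>t\<close> for \<open>v\<close> yield \<open>s + t\<close> for \<open>u + v\<close>, and
  \<open>t\<close> for \<open>v\<close> yields \<open>c * t\<close> for
  \<open>c *\<^sub>R v\<close>.\<close>

lemma sublinear_sublinear_tilt:
  assumes p: "sublinear p"
  shows "sublinear (sublinear_tilt p y)"
proof (rule sublinearI)
  let ?q = "sublinear_tilt p y"
  have attain: "\<exists>t\<ge>0. p (v + t *\<^sub>R y) - t * p y < ?q v + e" if "e > 0" for v e
  proof (rule ccontr)
    assume "\<not> ?thesis"
    then have "?q v + e \<le> ?q v"
      unfolding sublinear_tilt_def[of p y v] by (intro cINF_greatest) (auto simp: not_less)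
    with that show False by simp
  qed
  fix u v :: 'a
  show "?q (u + v) \<le> ?q u + ?q v"
  proof (rule field_le_epsilon)
    fix e :: real
    assume "e > 0"
    then obtain s t where s: "s \<ge> 0" "p (u + s *\<^sub>R y) - s * p y < ?q u + e / 2"
      and t: "t \<ge> 0" "p (v + t *\<^sub>R y) - t * p y < ?q v + e / 2"
      using attain[of "e / 2"] by (meson half_gt_zero)
    have "?q (u + v) \<le> p ((u + v) + (s + t) *\<^sub>R y) - (s + t) * p y"
      using s t by (intro sublinear_tilt_le p) simp
    also have "\<dots> \<le> (p (u + s *\<^sub>R y) - s * p y) + (p (v + t *\<^sub>R y) - t * p y)"
      using sublinear_add[OF p, of "u + s *\<^sub>R y" "v + t *\<^sub>R y"] by (simp add: algebra_simps)
    finally show "?q (u + v) \<le> ?q u + ?q v + e"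
      using s t by simp
  qed
  fix c :: real
  assume c: "c > 0"
  show "?q (c *\<^sub>R v) \<le> c * ?q v"
  proof (rule field_le_epsilon)
    fix e :: real
    assume "e > 0"
    then obtain t where t: "t \<ge> 0" "p (v + t *\<^sub>R y) - t * p y < ?q v + e / c"
      using attain[of "e / c" v] c by auto
    have "?q (c *\<^sub>R v) \<le> p (c *\<^sub>R v + (c * t) *\<^sub>R y) - (c * t) * p y"
      using c t by (intro sublinear_tilt_le p) simp
    also have "\<dots> = c * (p (v + t *\<^sub>R y) - t * p y)"
      using sublinear_scaleR[OF p c, of "v + t *\<^sub>R y"] by (simp add: algebra_simps)
    also have "\<dots> \<le> c * (?q v + e / c)"
      using c t by (intro mult_left_mono) auto
    finally show "?q (c *\<^sub>R v) \<le> c * ?q v + e"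
      using c by (simp add: algebra_simps)
  qed
next
  have "sublinear_tilt p y 0 = (INF t\<in>{0::real..}. (0::real))"
    unfolding sublinear_tilt_def
    by (intro INF_cong refl)
      (metis add_0 atLeast_iff diff_self less_eq_real_def mult_zero_left p scale_zero_left
        sublinear_0 sublinear_scaleR)
  then show "sublinear_tilt p y 0 = 0" by simp
qed

text \<open>Provides the lower bounds for Zorn's lemma. The infimum is finite because
  \<open>- p (- v) \<le> - q (- v) \<le> q v\<close>. It stays subadditive because approximate
  minimisers for \<open>u\<close> and \<open>v\<close> can both be replaced by the smaller of the
  two.\<close>

lemma sublinear_Inf_chain:
  assumes "C \<noteq> {}"
    and sub: "\<And>q. q \<in> C \<Longrightarrow> sublinear q"
    and le: "\<And>q v. q \<in> C \<Longrightarrow> q v \<le> p v"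
    and chain: "\<And>q q'. q \<in> C \<Longrightarrow> q' \<in> C \<Longrightarrow> q \<le> q' \<or> q' \<le> q"
  shows "sublinear (\<lambda>v. INF q\<in>C. q v)" and "\<And>q v. q \<in> C \<Longrightarrow> (INF q\<in>C. q v) \<le> q v"
proof -
  let ?i = "\<lambda>v. INF q\<in>C. q v"
  have bdd: "bdd_below ((\<lambda>q. q v) ` C)" for v
    by (rule bdd_belowI2[of _ "- p (- v)"])
      (meson le neg_le_iff_le order_trans sub sublinear_minus_ge)
  show low: "?i v \<le> q v" if "q \<in> C" for q v
    using bdd that by (rule cINF_lower)
  have attain: "\<exists>q\<in>C. q v < ?i v + e" if "e > 0" for v e
    using cINF_less_iff[OF \<open>C \<noteq> {}\<close> bdd[of v], of "?i v + e"] that by simp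
  show "sublinear ?i"
  proof (rule sublinearI)
    fix u v
    show "?i (u + v) \<le> ?i u + ?i v"
    proof (rule field_le_epsilon)
      fix e :: real
      assume "e > 0"
      then obtain q q' where q: "q \<in> C" "q u < ?i u + e / 2" "q' \<in> C" "q' v < ?i v + e / 2"
        using attain[of "e / 2"] by (meson half_gt_zero)
      obtain r where r: "r \<in> C" "r \<le> q" "r \<le> q'"
        using chain[OF q(1,3)] q by blast
      have "?i (u + v) \<le> r (u + v)" using r(1) by (rule low)
      also have "\<dots> \<le> r u + r v" using sub[OF r(1)] by (rule sublinear_add)
      also have "\<dots> \<le> q u + q' v" using r by (intro add_mono) (auto dest: le_funD)
      finally show "?i (u + v) \<le> ?i u + ?i v + e" using q by simp
    qed
    fix c :: real
    assume c: "c > 0"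
    show "?i (c *\<^sub>R v) \<le> c * ?i v"
    proof (rule field_le_epsilon)
      fix e :: real
      assume "e > 0"
      then obtain q where q: "q \<in> C" "q v < ?i v + e / c"
        using attain[of "e / c" v] c by auto
      have "?i (c *\<^sub>R v) \<le> c * q v"
        using low[OF q(1)] sublinear_scaleR[OF sub[OF q(1)] c] by metis
      also have "\<dots> \<le> c * (?i v + e / c)"
        using c q by (intro mult_left_mono) auto
      finally show "?i (c *\<^sub>R v) \<le> c * ?i v + e"
        using c by (simp add: algebra_simps)
    qed
  next
    have "?i 0 = (INF q\<in>C. 0)"
      by (intro INF_cong refl) (simp add: sub sublinear_0)
    then show "?i 0 = 0" using \<open>C \<noteq> {}\<close> by simp
  qed
qed

text \<open>Zorn's lemma in the reversed pointwise order gives a minimal sublinear functional below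
  \<open>p\<close>. A nonempty chain is bounded by its pointwise infimum, the empty one by
  \<open>p\<close>.\<close>

lemma sublinear_ge_linear:
  assumes p: "sublinear (p :: 'v::real_vector \<Rightarrow> real)"
  shows "\<exists>f. linear f \<and> (\<forall>v. f v \<le> p v)"
proof -
  define A where "A = {q. sublinear q \<and> q \<le> p}"
  have "\<exists>m\<in>A. \<forall>a\<in>A. a \<le> m \<longrightarrow> a = m"
  proof (rule predicate_Zorn[where P = "\<lambda>q q'. q' \<le> q"])
    show "partial_order_on A (relation_of (\<lambda>q q'. q' \<le> q) A)"
      by (rule partial_order_on_relation_ofI) auto
    fix C
    assume "C \<in> Chains (relation_of (\<lambda>q q'. q' \<le> q) A)"
    then have C: "C \<subseteq> A" and chain: "\<And>q q'. q \<in> C \<Longrightarrow> q' \<in> C \<Longrightarrow> q \<le> q' \<or> q' \<le> q"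
      unfolding Chains_def relation_of_def by blast+
    show "\<exists>u\<in>A. \<forall>a\<in>C. u \<le> a"
    proof (cases "C = {}")
      case True
      then show ?thesis using p unfolding A_def by auto
    next
      case False
      have sub: "\<And>q. q \<in> C \<Longrightarrow> sublinear q" and le: "\<And>q v. q \<in> C \<Longrightarrow> q v \<le> p v"
        using C unfolding A_def by (auto dest: le_funD)
      have inf: "sublinear (\<lambda>v. INF q\<in>C. q v)" "\<And>q v. q \<in> C \<Longrightarrow> (INF q\<in>C. q v) \<le> q v"
        using sublinear_Inf_chain[of C p] False sub le chain by blast+
      from False obtain q where "q \<in> C" by blast
      then have "(\<lambda>v. INF q\<in>C. q v) \<in> A"
        unfolding A_def using inf(1) inf(2)[OF \<open>q \<in> C\<close>] le[OF \<open>q \<in> C\<close>]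
        by (auto intro!: le_funI intro: order_trans)
      then show ?thesis using inf(2) by (auto intro!: bexI le_funI)
    qed
  qed
  then obtain q where q: "sublinear q" "q \<le> p" and min: "\<And>a. a \<in> A \<Longrightarrow> a \<le> q \<Longrightarrow> a = q"
    unfolding A_def by auto
  have tilt: "sublinear_tilt q y = q" for y
  proof (rule min)
    show "sublinear_tilt q y \<le> q"
      using sublinear_tilt_le[OF q(1), of 0 y] by (auto intro: le_funI)
    then show "sublinear_tilt q y \<in> A"
      using q sublinear_sublinear_tilt[OF q(1)] unfolding A_def by auto
  qed
  \<comment> \<open>Since \<open>q\<close> equals its tilt along \<open>v\<close>, the parameter 1
    gives \<open>q u \<le> q (u + v) - q v\<close>, the converse of subadditivity.\<close>
  have add: "q (u + v) = q u + q v" for u v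
    using sublinear_tilt_le[OF q(1), of 1 v u] sublinear_add[OF q(1), of u v] tilt[of v] by simp
  have neg: "q (- v) = - q v" for v
    using add[of v "- v"] sublinear_0[OF q(1)] by simp
  have "q (c *\<^sub>R v) = c * q v" for c v
  proof (cases c "0::real" rule: linorder_cases)
    case less
    then show ?thesis
      using sublinear_scaleR[OF q(1), of "- c" v] neg[of "c *\<^sub>R v"] by simp
  qed (use sublinear_0[OF q(1)] sublinear_scaleR[OF q(1)] in auto)
  then have "linear q"
    using add by (intro linearI) auto
  then show ?thesis
    using q by (auto dest: le_funD)
qed

text \<open>A linear functional below the tilt along \<open>y\<close> is below \<open>p\<close>
  (parameter 0). At \<open>- y\<close> the parameter 1 gives \<open>f (- y) \<le> - p y\<close>,
  which forces equality at \<open>y\<close>.\<close>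

lemma sublinear_support_linear:
  assumes p: "sublinear (p :: 'v::real_vector \<Rightarrow> real)"
  shows "\<exists>f. linear f \<and> (\<forall>v. f v \<le> p v) \<and> f y = p y"
proof -
  obtain f where f: "linear f" "\<And>v. f v \<le> sublinear_tilt p y v"
    using sublinear_ge_linear[OF sublinear_sublinear_tilt[OF p, of y]] by blast
  have le: "f v \<le> p v" for v
    using f(2)[of v] sublinear_tilt_le[OF p, of 0 y v] by simp
  have "f (- y) \<le> - p y"
    using f(2)[of "- y"] sublinear_tilt_le[OF p, of 1 y "- y"] sublinear_0[OF p] by simp
  then have "f y = p y"
    using le[of y] linear_neg[OF f(1), of y] by simp
  with f le show ?thesis by blast
qed

lemma sublinear_infdist_subspace:
  fixes S :: "'v::real_normed_vector set"
  assumes S: "subspace S"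
  shows "sublinear (\<lambda>v. infdist v S)"
proof (rule sublinearI)
  have ne: "S \<noteq> {}" using subspace_0[OF S] by blast
  have attain: "\<exists>s\<in>S. dist v s < infdist v S + e" if "e > 0" for v e
    using cINF_less_iff[OF ne bdd_below_image_dist, of v "infdist v S + e"] that ne
    by (simp add: infdist_notempty)
  fix u v :: 'v
  show "infdist (u + v) S \<le> infdist u S + infdist v S"
  proof (rule field_le_epsilon)
    fix e :: real
    assume "e > 0"
    then obtain s t where s: "s \<in> S" "dist u s < infdist u S + e / 2"
      and t: "t \<in> S" "dist v t < infdist v S + e / 2"
      using attain[of "e / 2"] by (meson half_gt_zero)
    have "infdist (u + v) S \<le> dist (u + v) (s + t)"
      using subspace_add[OF S s(1) t(1)] by (rule infdist_le)
    also have "\<dots> \<le> dist u s + dist v t"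
      by (rule dist_triangle_add)
    finally show "infdist (u + v) S \<le> infdist u S + infdist v S + e"
      using s t by simp
  qed
  fix c :: real
  assume c: "c > 0"
  show "infdist (c *\<^sub>R v) S \<le> c * infdist v S"
  proof (rule field_le_epsilon)
    fix e :: real
    assume "e > 0"
    then obtain s where s: "s \<in> S" "dist v s < infdist v S + e / c"
      using attain[of "e / c" v] c by auto
    have "infdist (c *\<^sub>R v) S \<le> dist (c *\<^sub>R v) (c *\<^sub>R s)"
      using subspace_scale[OF S s(1)] by (rule infdist_le)
    also have "\<dots> = c * dist v s"
      using c by (simp add: dist_norm flip: scaleR_diff_right)
    also have "\<dots> \<le> c * (infdist v S + e / c)"
      using c s by (intro mult_left_mono) auto
    finally show "infdist (c *\<^sub>R v) S \<le> c * infdist v S + e"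
      using c by (simp add: algebra_simps)
  qed
next
  show "infdist 0 S = 0"
    using subspace_0[OF S] by simp
qed

text \<open>The dominating sublinear functional is the distance to \<open>S\<close>: it is at most
  the norm, vanishes on \<open>S\<close>, and is nonzero at \<open>m\<close>, where the linear
  functional is chosen to attain it.\<close>

lemma Hahn_Banach_separation_subspace:
  fixes S :: "'v::real_normed_vector set"
  assumes S: "subspace S" and "m \<notin> closure S"
  shows "\<exists>f. linear f \<and> (\<forall>v. \<bar>f v\<bar> \<le> norm v) \<and> (\<forall>s\<in>S. f s = 0) \<and> f m \<noteq> 0"
proof -
  obtain f where f: "linear f" "\<And>v. f v \<le> infdist v S" "f m = infdist m S"
    using sublinear_support_linear[OF sublinear_infdist_subspace[OF S]] by blast
  have "f v \<le> norm v" for v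
    using f(2)[of v] infdist_le[OF subspace_0[OF S], of v] by simp
  from this this[of "- v" for v] have "\<bar>f v\<bar> \<le> norm v" for v
    using linear_neg[OF f(1), of v] by (metis abs_le_iff norm_minus_cancel)
  moreover have "f s = 0" if "s \<in> S" for s
    using f(2)[of s] f(2)[of "- s"] linear_neg[OF f(1), of s] that subspace_neg[OF S that] by simp
  moreover have "f m \<noteq> 0"
    using assms f(3) in_closure_iff_infdist_zero[of S m] subspace_0[OF S] by auto
  ultimately show ?thesis using f(1) by blast
qed

section \<open>Duality between free spaces and Lipschitz functions\<close>

lemma lip0_apply_Lip0:
  "L-lipschitz_on UNIV f \<Longrightarrow> f base_point = 0 \<Longrightarrow> lip0_apply (Lip0 f) = f"
  by (auto intro: Lip0_inverse)

lemma norm_lip0_le: "L-lipschitz_on UNIV (lip0_apply f) \<Longrightarrow> norm f \<le> L"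
  unfolding norm_lip0_def by (rule lipschitz_constant_le)

lemma norm_delta_diff_le: "norm (delta x - delta y) \<le> dist x y"
proof (rule norm_blinfun_bound)
  fix f
  show "norm (blinfun_apply (delta x - delta y) f) \<le> dist x y * norm f"
    using lipschitz_onD[OF lip0_lipschitz_norm, of x y f]
    by (simp add: blinfun.diff_left delta.rep_eq dist_norm mult.commute)
qed simp

lemma free_space_on_mono: "K \<subseteq> K' \<Longrightarrow> free_space_on K \<subseteq> free_space_on K'"
  unfolding free_space_on_def by (intro closure_mono span_mono) auto

text \<open>Two continuous linear functionals agree on a closed subspace, so agreement on the
  generators is enough.\<close>

lemma free_space_on_induct:
  assumes "m \<in> free_space_on K"
    and "linear F" "linear G" "continuous_on UNIV F" "continuous_on UNIV G"
    and "\<And>x. x \<in> K \<Longrightarrow> F (delta x) = G (delta x)"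
  shows "F m = (G m :: real)"
proof -
  have "span (delta ` K) \<subseteq> {m. F m = G m}"
    using assms(6) linear_eq_on_span[OF assms(2,3)] by blast
  moreover have "closed {m. F m = G m}"
    using assms(4,5) by (rule closed_Collect_eq)
  ultimately have "free_space_on K \<subseteq> {m. F m = G m}"
    unfolding free_space_on_def by (rule closure_minimal)
  with assms(1) show ?thesis by blast
qed

lemma blinfun_apply_linear_left: "linear (\<lambda>m. blinfun_apply m f)"
  by (intro linearI) (auto simp: blinfun.add_left blinfun.scaleR_left)

lemma free_space_on_apply_eq_0:
  assumes "m \<in> free_space_on K" and "\<And>x. x \<in> K \<Longrightarrow> lip0_apply f x = 0"
  shows "blinfun_apply m f = 0"
  using assms(1)
  by (rule free_space_on_induct[where G = "\<lambda>_. 0"])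
    (auto simp: blinfun_apply_linear_left linear_zero delta.rep_eq assms(2) intro!: continuous_intros)

text \<open>\<open>A\<close> carries a finite combination \<open>m'\<close> of evaluations with
  \<open>dist m' m < e\<close>. A function vanishing on \<open>A\<close> is annihilated by
  \<open>m'\<close>, so only the error \<open>m' - m\<close> acts on it.\<close>

lemma free_space_finite_approx:
  assumes "m \<in> free_space" and "e > 0"
  shows "\<exists>A. finite A \<and> (\<forall>g. (\<forall>x\<in>A. lip0_apply g x = 0) \<longrightarrow> \<bar>blinfun_apply m g\<bar> \<le> e * norm g)"
proof -
  obtain m' where m': "m' \<in> span (range delta)" "dist m' m < e"
    using assms unfolding free_space_on_def closure_approachable by blast
  obtain T c where T: "finite T" "T \<subseteq> range delta" "m' = (\<Sum>a\<in>T. c a *\<^sub>R a)"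
    using m'(1) unfolding span_explicit by blast
  obtain A where A: "finite A" "T = delta ` A"
    using T(1,2) by (meson finite_subset_image)
  have "\<bar>blinfun_apply m g\<bar> \<le> e * norm g" if "\<forall>x\<in>A. lip0_apply g x = 0" for g
  proof -
    have "blinfun_apply m' g = 0"
      unfolding T(3) A(2) blinfun.sum_left
      by (rule sum.neutral) (auto simp: blinfun.scaleR_left delta.rep_eq that)
    then have "\<bar>blinfun_apply m g\<bar> = norm (blinfun_apply (m' - m) g)"
      by (simp add: blinfun.diff_left)
    also have "\<dots> \<le> norm (m' - m) * norm g"
      by (rule norm_blinfun)
    also have "\<dots> \<le> e * norm g"
      using m'(2) by (intro mult_right_mono) (auto simp: dist_norm)
    finally show ?thesis .
  qed
  with A(1) show ?thesis by blast
qed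

text \<open>On \<open>free_space\<close>, a separating functional \<open>\<phi>\<close> is evaluation at the function \<open>x \<mapsto> \<phi> (delta x)\<close>.\<close>

lemma free_space_on_bipolar:
  assumes m: "m \<in> free_space"
    and van: "\<And>f. (\<And>x. x \<in> K \<Longrightarrow> lip0_apply f x = 0) \<Longrightarrow> blinfun_apply m f = 0"
  shows "m \<in> free_space_on K"
proof (rule ccontr)
  assume "m \<notin> free_space_on K"
  then obtain \<phi> where \<phi>: "linear \<phi>" "\<And>v. \<bar>\<phi> v\<bar> \<le> norm v" "\<And>s. s \<in> span (delta ` K) \<Longrightarrow> \<phi> s = 0"
    and ne: "\<phi> m \<noteq> 0"
    using Hahn_Banach_separation_subspace[OF subspace_span, of m "delta ` K"]
    unfolding free_space_on_def by blast
  have "bounded_linear \<phi>"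
    using \<phi> by (intro bounded_linear_intro[where K = 1]) (auto simp: linear_add linear_scale)
  then have cont: "continuous_on UNIV \<phi>"
    by (simp add: linear_continuous_on)
  have lip: "1-lipschitz_on UNIV (\<lambda>x. \<phi> (delta x))"
  proof (rule lipschitz_onI)
    fix x y :: 'a
    show "dist (\<phi> (delta x)) (\<phi> (delta y)) \<le> 1 * dist x y"
      using \<phi>(2)[of "delta x - delta y"] norm_delta_diff_le[of x y] linear_diff[OF \<phi>(1)]
      by (simp add: dist_norm)
  qed simp
  have "delta (base_point :: 'a) = 0"
    by (rule blinfun_eqI) (simp add: delta.rep_eq)
  then have f: "lip0_apply (Lip0 (\<lambda>x. \<phi> (delta x))) = (\<lambda>x. \<phi> (delta x))"
    using lip linear_0[OF \<phi>(1)] by (intro lip0_apply_Lip0) auto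
  have "blinfun_apply m (Lip0 (\<lambda>x. \<phi> (delta x))) = \<phi> m"
    using m
    by (rule free_space_on_induct)
      (auto simp: blinfun_apply_linear_left \<phi>(1) cont delta.rep_eq f intro!: continuous_intros)
  moreover have "blinfun_apply m (Lip0 (\<lambda>x. \<phi> (delta x))) = 0"
    using \<phi>(3) by (intro van) (auto simp: f span_base)
  ultimately show False using ne by simp
qed

section \<open>Lattice operations and products of Lipschitz functions\<close>

lemma lipschitz_on_max_real:
  fixes f g :: "'a::metric_space \<Rightarrow> real"
  assumes "L-lipschitz_on U f" "L-lipschitz_on U g"
  shows "L-lipschitz_on U (\<lambda>x. max (f x) (g x))"
proof (rule lipschitz_onI)
  fix x y
  assume "x \<in> U" "y \<in> U"
  then show "dist (max (f x) (g x)) (max (f y) (g y)) \<le> L * dist x y"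
    using assms[THEN lipschitz_onD, of x y] unfolding dist_real_def by linarith
qed (use assms lipschitz_on_nonneg in blast)

lemma lipschitz_on_min_real:
  fixes f g :: "'a::metric_space \<Rightarrow> real"
  assumes "L-lipschitz_on U f" "L-lipschitz_on U g"
  shows "L-lipschitz_on U (\<lambda>x. min (f x) (g x))"
proof (rule lipschitz_onI)
  fix x y
  assume "x \<in> U" "y \<in> U"
  then show "dist (min (f x) (g x)) (min (f y) (g y)) \<le> L * dist x y"
    using assms[THEN lipschitz_onD, of x y] unfolding dist_real_def by linarith
qed (use assms lipschitz_on_nonneg in blast)

text \<open>The sup bounds enter the Lipschitz constant of the product. This is why functions are
  kept bounded whenever they are multiplied by cutoffs.\<close>

lemma lipschitz_on_mult_real:
  fixes f g :: "'a::metric_space \<Rightarrow> real"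
  assumes f: "L-lipschitz_on U f" "\<And>x. x \<in> U \<Longrightarrow> \<bar>f x\<bar> \<le> B"
    and g: "M-lipschitz_on U g" "\<And>x. x \<in> U \<Longrightarrow> \<bar>g x\<bar> \<le> C"
    and "0 \<le> B" "0 \<le> C"
  shows "(L * C + B * M)-lipschitz_on U (\<lambda>x. f x * g x)"
proof (rule lipschitz_onI)
  have "0 \<le> L" "0 \<le> M" using f g lipschitz_on_nonneg by auto
  then show "0 \<le> L * C + B * M" using assms by simp
  fix x y
  assume xy: "x \<in> U" "y \<in> U"
  have "\<bar>f x * g x - f y * g y\<bar> = \<bar>(f x - f y) * g x + f y * (g x - g y)\<bar>"
    by (simp add: algebra_simps)
  also have "\<dots> \<le> \<bar>f x - f y\<bar> * \<bar>g x\<bar> + \<bar>f y\<bar> * \<bar>g x - g y\<bar>"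
    using abs_triangle_ineq by (simp flip: abs_mult)
  also have "\<dots> \<le> (L * dist x y) * C + B * (M * dist x y)"
    using f g xy lipschitz_onD[OF f(1) xy] lipschitz_onD[OF g(1) xy] \<open>0 \<le> L\<close> \<open>0 \<le> B\<close>
    by (intro add_mono mult_mono) (auto simp: dist_real_def)
  finally show "dist (f x * g x) (f y * g y) \<le> (L * C + B * M) * dist x y"
    by (simp add: dist_real_def algebra_simps)
qed

section \<open>Localization and concentration points\<close>

text \<open>The cutoff is built one point at a time by taking the maximum with a tent of radius
  \<open>r\<close>. Maxima keep the constant \<open>1 / r\<close> however many points there are, and
  each increment is supported in one ball, so \<open>null\<close> shows that \<open>m\<close>
  annihilates its product with \<open>g\<close>.\<close>

lemma finite_cover_cutoff:
  fixes m :: "'a::pointed_metric_space lip0 \<Rightarrow>\<^sub>L real"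
  assumes "finite A" and "r > 0"
    and bdd: "\<And>x. \<bar>lip0_apply g x\<bar> \<le> B"
    and null: "\<And>g' a B'. (\<And>x. \<bar>lip0_apply g' x\<bar> \<le> B') \<Longrightarrow>
      {x. lip0_apply g' x \<noteq> 0} \<subseteq> {x. lip0_apply g x \<noteq> 0} \<inter> ball a r \<Longrightarrow> blinfun_apply m g' = 0"
  shows "\<exists>u. (1 / r)-lipschitz_on UNIV u \<and> (\<forall>x. 0 \<le> u x \<and> u x \<le> 1) \<and> (\<forall>a\<in>A. u a = 1) \<and>
    blinfun_apply m (Lip0 (\<lambda>x. lip0_apply g x * u x)) = 0"
  using \<open>finite A\<close>
proof (induction A rule: finite_induct)
  case empty
  have "Lip0 (\<lambda>x. 0) = (0 :: 'a lip0)"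
    by (simp add: zero_lip0_def)
  then show ?case
    using \<open>r > 0\<close> by (intro exI[of _ "\<lambda>_. 0"]) (auto intro: lipschitz_on_constant lipschitz_on_le)
next
  case (insert a A)
  then obtain u where u: "(1 / r)-lipschitz_on UNIV u" "\<And>x. 0 \<le> u x" "\<And>x. u x \<le> 1"
    "\<And>a. a \<in> A \<Longrightarrow> u a = 1" and mu: "blinfun_apply m (Lip0 (\<lambda>x. lip0_apply g x * u x)) = 0"
    by blast
  have "0 \<le> B" using bdd[of base_point] by simp
  define w where "w x = max (u x) (1 - dist x a / r)" for x
  have "(1 / r)-lipschitz_on UNIV (\<lambda>x. 1 - dist x a / r)"
  proof (rule lipschitz_onI)
    fix x y
    have "\<bar>dist x a - dist y a\<bar> \<le> dist x y"
      using dist_triangle[of x a y] dist_triangle[of y a x] dist_commute[of x y] by linarith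
    then show "dist (1 - dist x a / r) (1 - dist y a / r) \<le> 1 / r * dist x y"
      using \<open>r > 0\<close> by (simp add: dist_real_def abs_minus_commute divide_right_mono flip: diff_divide_distrib)
  qed (use \<open>r > 0\<close> in simp)
  then have w: "(1 / r)-lipschitz_on UNIV w"
    unfolding w_def using u(1) by (intro lipschitz_on_max_real)
  have w01: "0 \<le> w x" "w x \<le> 1" "u x \<le> w x" for x
    using u(2,3)[of x] \<open>r > 0\<close> unfolding w_def by auto
  have w1: "w b = 1" if "b \<in> insert a A" for b
    using that u(4)[of b] w01(2,3)[of b] unfolding w_def by auto
  have ap_mult: "lip0_apply (Lip0 (\<lambda>x. lip0_apply g x * h x)) = (\<lambda>x. lip0_apply g x * h x)"
    if "L-lipschitz_on UNIV h" "\<And>x. \<bar>h x\<bar> \<le> 1" for h L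
    using lipschitz_on_mult_real[OF lip0_lipschitz_norm bdd that] \<open>0 \<le> B\<close>
    by (intro lip0_apply_Lip0) auto
  have diff: "(1 / r + 1 / r)-lipschitz_on UNIV (\<lambda>x. w x - u x)"
    using w u(1) by (rule lipschitz_on_diff)
  have diff1: "\<bar>w x - u x\<bar> \<le> 1" for x
    using w01[of x] u(2)[of x] by linarith
  have "\<bar>u x\<bar> \<le> 1" "\<bar>w x\<bar> \<le> 1" for x
    using u(2,3)[of x] w01(1,2)[of x] by simp_all
  note ap = ap_mult[OF u(1) this(1)] ap_mult[OF w this(2)] ap_mult[OF diff diff1]
  have "blinfun_apply m (Lip0 (\<lambda>x. lip0_apply g x * (w x - u x))) = 0"
  proof (rule null)
    fix x
    have "\<bar>lip0_apply g x\<bar> * \<bar>w x - u x\<bar> \<le> B * 1"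
      using bdd[of x] diff1[of x] \<open>0 \<le> B\<close> by (intro mult_mono) auto
    then show "\<bar>lip0_apply (Lip0 (\<lambda>x. lip0_apply g x * (w x - u x))) x\<bar> \<le> B"
      by (simp add: ap abs_mult)
  next
    \<comment> \<open>Where \<open>w\<close> differs from \<open>u\<close>, the tent exceeds
      \<open>u x \<ge> 0\<close>, so it is positive and \<open>x\<close> lies within
      \<open>r\<close> of \<open>a\<close>.\<close>
    have "x \<in> ball a r" if "w x \<noteq> u x" for x
    proof -
      have "1 - dist x a / r > 0"
        using that u(2)[of x] unfolding w_def by linarith
      then show ?thesis
        using \<open>r > 0\<close> by (simp add: dist_commute)
    qed
    then show "{x. lip0_apply (Lip0 (\<lambda>x. lip0_apply g x * (w x - u x))) x \<noteq> 0}
        \<subseteq> {x. lip0_apply g x \<noteq> 0} \<inter> ball a r"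
      by (auto simp: ap)
  qed
  moreover have "Lip0 (\<lambda>x. lip0_apply g x * w x) =
      Lip0 (\<lambda>x. lip0_apply g x * u x) + Lip0 (\<lambda>x. lip0_apply g x * (w x - u x))"
    by (intro lip0_eqI, simp only: ap lip0_apply_simps) (simp add: algebra_simps)
  ultimately have "blinfun_apply m (Lip0 (\<lambda>x. lip0_apply g x * w x)) = 0"
    using mu by (simp add: blinfun.add_right)
  then show ?case
    using w w01 w1 by blast
qed

text \<open>If \<open>m\<close> annihilated every such piece, it would annihilate
  \<open>g * u\<close> for a cutoff \<open>u\<close> equal to 1 on any given finite set. The rest
  \<open>g * (1 - u)\<close> vanishes on that set, and its norm is bounded independently of the set,
  so finite approximation gives \<open>m g = 0\<close>.\<close>

lemma free_space_localize:
  assumes m: "m \<in> free_space" and bdd: "\<And>x. \<bar>lip0_apply g x\<bar> \<le> B"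
    and ne: "blinfun_apply m g \<noteq> 0" and "r > 0"
  shows "\<exists>g' a B'. (\<forall>x. \<bar>lip0_apply g' x\<bar> \<le> B') \<and> blinfun_apply m g' \<noteq> 0 \<and>
    {x. lip0_apply g' x \<noteq> 0} \<subseteq> {x. lip0_apply g x \<noteq> 0} \<inter> ball a r"
proof (rule ccontr)
  assume none: "\<not> ?thesis"
  have "0 \<le> B" using bdd[of base_point] by simp
  \<comment> \<open>The product bound for \<open>g * (1 - u)\<close>, with sup bounds
    \<open>B\<close> and 1 and Lipschitz constants \<open>norm g\<close> and \<open>1 / r\<close>.
    It depends on neither the finite set nor \<open>e\<close>.\<close>
  define C where "C = norm g * 1 + B * (1 / r)"
  have "C \<ge> 0"
    unfolding C_def using \<open>0 \<le> B\<close> \<open>r > 0\<close> by simp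
  have le: "\<bar>blinfun_apply m g\<bar> \<le> e * C" if "e > 0" for e
  proof -
    obtain A where A: "finite A"
      "\<And>f. (\<And>x. x \<in> A \<Longrightarrow> lip0_apply f x = 0) \<Longrightarrow> \<bar>blinfun_apply m f\<bar> \<le> e * norm f"
      using free_space_finite_approx[OF m \<open>e > 0\<close>] by blast
    obtain u where u: "(1 / r)-lipschitz_on UNIV u" "\<And>x. 0 \<le> u x" "\<And>x. u x \<le> 1"
      "\<And>a. a \<in> A \<Longrightarrow> u a = 1" and mu: "blinfun_apply m (Lip0 (\<lambda>x. lip0_apply g x * u x)) = 0"
      using finite_cover_cutoff[OF A(1) \<open>r > 0\<close> bdd, where m = m] none by (smt (verit))
    let ?gu = "Lip0 (\<lambda>x. lip0_apply g x * u x)"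
    have "\<bar>u x\<bar> \<le> 1" for x using u(2,3)[of x] by simp
    from lipschitz_on_mult_real[OF lip0_lipschitz_norm bdd u(1) this]
    have ap: "lip0_apply ?gu = (\<lambda>x. lip0_apply g x * u x)"
      using \<open>0 \<le> B\<close> by (intro lip0_apply_Lip0) auto
    have "(1 / r)-lipschitz_on UNIV (\<lambda>x. 1 - u x)"
      using u(1) by (auto simp: lipschitz_on_def dist_real_def abs_minus_commute)
    moreover have "\<bar>1 - u x\<bar> \<le> 1" for x using u(2,3)[of x] by simp
    ultimately have "C-lipschitz_on UNIV (\<lambda>x. lip0_apply g x * (1 - u x))"
      unfolding C_def using \<open>0 \<le> B\<close> bdd by (intro lipschitz_on_mult_real lip0_lipschitz_norm) auto
    then have "norm (g - ?gu) \<le> C"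
      by (intro norm_lip0_le) (simp add: ap right_diff_distrib)
    moreover have "\<bar>blinfun_apply m (g - ?gu)\<bar> \<le> e * norm (g - ?gu)"
      using u(4) by (intro A(2)) (simp add: ap)
    ultimately have "\<bar>blinfun_apply m (g - ?gu)\<bar> \<le> e * C"
      using \<open>e > 0\<close> by (meson less_imp_le mult_left_mono order_trans)
    then show ?thesis
      by (simp add: blinfun.diff_right mu)
  qed
  have "\<bar>blinfun_apply m g\<bar> \<le> 0"
  proof (rule field_le_epsilon)
    fix e :: real
    assume "e > 0"
    \<comment> \<open>The shift by 1 makes the denominator positive from \<open>C \<ge> 0\<close>
      alone.\<close>
    then have "\<bar>blinfun_apply m g\<bar> \<le> e / (C + 1) * C"
      using \<open>C \<ge> 0\<close> by (intro le) simp
    also have "\<dots> \<le> e"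
      using \<open>C \<ge> 0\<close> \<open>e > 0\<close> by (simp add: field_simps)
    finally show "\<bar>blinfun_apply m g\<bar> \<le> 0 + e" by simp
  qed
  with ne show False by simp
qed

text \<open>Cantor's intersection argument: repeated localization gives nested supports of shrinking
  diameter, nonempty because \<open>m\<close> is nonzero on each function. Points chosen from them
  converge by completeness. The limit need not lie in the supports, only arbitrarily close to
  them.\<close>

lemma free_space_concentration_point:
  fixes g :: "'a::{pointed_metric_space, complete_space} lip0"
  assumes m: "m \<in> free_space" and bdd: "\<And>x. \<bar>lip0_apply g x\<bar> \<le> B"
    and ne: "blinfun_apply m g \<noteq> 0"
  shows "\<exists>x. \<forall>e>0. \<exists>g'. blinfun_apply m g' \<noteq> 0 \<and>
    {y. lip0_apply g' y \<noteq> 0} \<subseteq> {y. lip0_apply g y \<noteq> 0} \<inter> ball x e"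
proof -
  define S where "S h = {y. lip0_apply h y \<noteq> 0}" for h :: "'a lip0"
  define P where "P n h \<longleftrightarrow> (\<exists>B. \<forall>x. \<bar>lip0_apply h x\<bar> \<le> B) \<and> blinfun_apply m h \<noteq> 0 \<and> S h \<subseteq> S g"
    for n :: nat and h
  \<comment> \<open>The radius is attached to the successor: \<open>G (Suc n)\<close>, not
    \<open>G n\<close>, is supported in a ball of radius \<open>(1/2) ^ n\<close>, hence the shifted
    indices below.\<close>
  define Q where "Q n h h' \<longleftrightarrow> S h' \<subseteq> S h \<and> (\<exists>a. S h' \<subseteq> ball a ((1/2) ^ n))"
    for n :: nat and h h'
  have "\<exists>G. \<forall>n. P n (G n) \<and> Q n (G n) (G (Suc n))"
  proof (rule dependent_nat_choice)
    show "\<exists>h. P 0 h" unfolding P_def using bdd ne by blast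
    fix h and n :: nat
    assume h: "P n h"
    then obtain B' where "\<And>x. \<bar>lip0_apply h x\<bar> \<le> B'" unfolding P_def by blast
    from free_space_localize[OF m this, of "(1/2) ^ n"] h
    show "\<exists>h'. P (Suc n) h' \<and> Q n h h'"
      unfolding P_def Q_def S_def by simp blast
  qed
  then obtain G where P: "\<And>n. P n (G n)" and Q: "\<And>n. Q n (G n) (G (Suc n))"
    by blast
  have mono: "S (G n) \<subseteq> S (G k)" if "k \<le> n" for k n
    using that by (induction rule: dec_induct) (use Q in \<open>auto simp: Q_def\<close>)
  have small: "dist y z \<le> 2 * (1/2) ^ n" if "y \<in> S (G (Suc n))" "z \<in> S (G (Suc n))" for n y z
  proof -
    obtain a where "S (G (Suc n)) \<subseteq> ball a ((1/2) ^ n)"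
      using Q[of n] unfolding Q_def by blast
    with that have "dist a y < (1/2) ^ n" "dist a z < (1/2) ^ n" by auto
    then show ?thesis using dist_triangle3[of y z a] by linarith
  qed
  have "\<exists>y. y \<in> S (G (Suc n))" for n
  proof (rule ccontr)
    assume "\<not> ?thesis"
    then have "G (Suc n) = 0" unfolding S_def by (intro lip0_eqI) simp
    then show False using P[of "Suc n"] unfolding P_def by simp
  qed
  then obtain y where y: "\<And>n. y n \<in> S (G (Suc n))" by metis
  have tail: "dist (y k) (y n) \<le> 2 * (1/2) ^ n" if "n \<le> k" for k n
    using y[of k] y[of n] mono[of "Suc n" "Suc k"] that by (intro small) auto
  have pow: "\<exists>n. c * (1/2 :: real) ^ n < e" if "e > 0" "c > 0" for c e
    using real_arch_pow_inv[of "e / c" "1/2"] that by (auto simp: field_simps)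
  have "Cauchy y"
  proof (rule metric_CauchyI)
    fix e :: real
    assume "e > 0"
    \<comment> \<open>Two tails of size \<open>2 * (1/2) ^ N\<close> are joined at
      \<open>y N\<close>.\<close>
    then obtain N where N: "4 * (1/2) ^ N < e" using pow[of e 4] by auto
    have "dist (y k) (y n) < e" if "N \<le> k" "N \<le> n" for k n
      using tail[OF that(1)] tail[OF that(2)] N dist_triangle2[of "y k" "y n" "y N"] by linarith
    then show "\<exists>N. \<forall>k\<ge>N. \<forall>n\<ge>N. dist (y k) (y n) < e" by blast
  qed
  then obtain x where x: "y \<longlonglongrightarrow> x"
    using Cauchy_convergent convergent_def by blast
  have near: "dist x (y n) \<le> 2 * (1/2) ^ n" for n
  proof (rule tendsto_upperbound[OF tendsto_dist[OF x tendsto_const]])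
    show "\<forall>\<^sub>F k in sequentially. dist (y k) (y n) \<le> 2 * (1/2) ^ n"
      using eventually_ge_at_top[of n] by eventually_elim (rule tail)
  qed simp
  show ?thesis
  proof (intro exI[of _ x] allI impI)
    fix e :: real
    assume "e > 0"
    \<comment> \<open>Half of the 4 covers the distance from \<open>x\<close> to \<open>y n\<close>,
      the other half that from \<open>y n\<close> to any point of the support.\<close>
    then obtain n where n: "4 * (1/2) ^ n < e" using pow[of e 4] by auto
    have "S (G (Suc n)) \<subseteq> ball x e"
    proof
      fix z
      assume "z \<in> S (G (Suc n))"
      then have "dist (y n) z \<le> 2 * (1/2) ^ n" using y by (intro small)
      then show "z \<in> ball x e"
        using near[of n] n dist_triangle[of x z "y n"] by simp
    qed
    with P[of "Suc n"] show "\<exists>g'. blinfun_apply m g' \<noteq> 0 \<and>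
        {y. lip0_apply g' y \<noteq> 0} \<subseteq> {y. lip0_apply g y \<noteq> 0} \<inter> ball x e"
      unfolding P_def S_def by blast
  qed
qed

section \<open>Truncation of Lipschitz functions\<close>

text \<open>For \<open>n \<ge> 1\<close>, \<open>clip n\<close> is odd and piecewise linear: it vanishes on \<open>[-1/(2n), 1/(2n)]\<close>, is the
  identity for \<open>1/n \<le> \<bar>t\<bar> \<le> n\<close>, and is constant beyond.\<close>

definition clip_pos :: "real \<Rightarrow> real \<Rightarrow> real"
  where "clip_pos n t = min n (max 0 (min t (2 * t - 1 / n)))"

definition clip :: "real \<Rightarrow> real \<Rightarrow> real"
  where "clip n t = clip_pos n t - clip_pos n (- t)"

text \<open>The point is uniformity in \<open>n\<close>. The ramp \<open>2 * t - 1 / n\<close> gives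
  each half the constant 2, and the two halves add up to 4.\<close>

lemma lipschitz_on_clip: "4-lipschitz_on UNIV (clip n)"
proof -
  have "2-lipschitz_on UNIV (\<lambda>t::real. t)" "2-lipschitz_on UNIV (\<lambda>t::real. 2 * t - 1 / n)"
    by (rule lipschitz_onI; simp add: dist_real_def abs_if)+
  then have "2-lipschitz_on UNIV (clip_pos n)"
    unfolding clip_pos_def
    by (intro lipschitz_on_min_real lipschitz_on_max_real)
      (auto intro: lipschitz_on_le[OF lipschitz_on_constant])
  moreover have "2-lipschitz_on UNIV (\<lambda>t. clip_pos n (- t))"
  proof (rule lipschitz_onI)
    fix s t
    show "dist (clip_pos n (- s)) (clip_pos n (- t)) \<le> 2 * dist s t"
      using lipschitz_onD[OF \<open>2-lipschitz_on UNIV (clip_pos n)\<close>, of "- s" "- t"]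
      by (simp add: dist_real_def abs_minus_commute)
  qed simp
  ultimately have "(2 + 2)-lipschitz_on UNIV (\<lambda>t. clip_pos n t - clip_pos n (- t))"
    by (rule lipschitz_on_diff)
  then show ?thesis unfolding clip_def[abs_def] by simp
qed

lemma clip_bounded: "n \<ge> 0 \<Longrightarrow> \<bar>clip n t\<bar> \<le> n"
  unfolding clip_def clip_pos_def by linarith

lemma clip_eq_0:
  assumes "n > 0" "\<bar>t\<bar> \<le> 1 / (2 * n)"
  shows "clip n t = 0"
proof -
  have "1 / (2 * n) = (1 / n) / 2" by simp
  then show ?thesis
    using assms unfolding clip_def clip_pos_def by linarith
qed

lemma clip_eq_self:
  assumes "n > 0" "1 / n \<le> \<bar>t\<bar>" "\<bar>t\<bar> \<le> n"
  shows "clip n t = t"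
proof -
  have "1 / n > 0" using assms by simp
  then show ?thesis
    using assms unfolding clip_def clip_pos_def by linarith
qed

text \<open>For large \<open>n\<close>, clipping leaves \<open>f\<close> unchanged on a given finite
  set, while the norm of the difference stays bounded. Finite approximation then makes
  \<open>m\<close> arbitrarily small on the difference.\<close>

lemma free_space_apply_eq_0_of_clip:
  assumes m: "m \<in> free_space"
    and null: "\<And>n g. n > 0 \<Longrightarrow> (\<And>x. lip0_apply g x = clip n (lip0_apply f x)) \<Longrightarrow> blinfun_apply m g = 0"
  shows "blinfun_apply m f = 0"
proof -
  \<comment> \<open>1 for \<open>f\<close> and 4 for its clipped version, whatever \<open>n\<close>
    is.\<close>
  define C where "C = 5 * norm f"
  have le: "\<bar>blinfun_apply m f\<bar> \<le> e * C" if "e > 0" for e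
  proof -
    obtain A where A: "finite A"
      "\<And>f. (\<And>x. x \<in> A \<Longrightarrow> lip0_apply f x = 0) \<Longrightarrow> \<bar>blinfun_apply m f\<bar> \<le> e * norm f"
      using free_space_finite_approx[OF m \<open>e > 0\<close>] by blast
    \<comment> \<open>A nonzero value \<open>t\<close> is fixed once \<open>n\<close> is at least
      \<open>\<bar>t\<bar>\<close> and \<open>1 / \<bar>t\<bar>\<close>, and 0 is always fixed.
      Finitely many values allow a common \<open>n\<close>.\<close>
    have "\<forall>\<^sub>F n in at_top. \<forall>a\<in>A. clip n (lip0_apply f a) = lip0_apply f a"
    proof (rule eventually_ball_finite[OF A(1)], rule ballI)
      fix a
      let ?t = "lip0_apply f a"
      show "\<forall>\<^sub>F n in at_top. clip n ?t = ?t"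
        using eventually_gt_at_top[of 0] eventually_ge_at_top[of "\<bar>?t\<bar>"]
          eventually_ge_at_top[of "1 / \<bar>?t\<bar>"]
      proof eventually_elim
        case (elim n)
        show ?case
        proof (cases "?t = 0")
          case True
          then show ?thesis by (simp add: clip_def)
        next
          case False
          then show ?thesis
            using elim by (intro clip_eq_self) (auto simp: field_simps)
        qed
      qed
    qed
    then have "\<forall>\<^sub>F n in at_top. n > 0 \<and> (\<forall>a\<in>A. clip n (lip0_apply f a) = lip0_apply f a)"
      using eventually_gt_at_top[of 0] by eventually_elim simp
    then obtain n where n: "n > 0" "\<And>a. a \<in> A \<Longrightarrow> clip n (lip0_apply f a) = lip0_apply f a"
      using eventually_happens'[OF trivial_limit_at_top_linorder] by blast
    let ?g = "Lip0 (\<lambda>x. clip n (lip0_apply f x))"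
    have lip: "(4 * norm f)-lipschitz_on UNIV (\<lambda>x. clip n (lip0_apply f x))"
      using lip0_lipschitz_norm lipschitz_on_subset[OF lipschitz_on_clip subset_UNIV]
      by (rule lipschitz_on_compose2)
    then have ap: "lip0_apply ?g = (\<lambda>x. clip n (lip0_apply f x))"
      by (rule lip0_apply_Lip0) (simp add: clip_def)
    have "norm ?g \<le> 4 * norm f"
      by (rule norm_lip0_le) (use lip ap in simp)
    then have "norm (f - ?g) \<le> C"
      unfolding C_def using norm_triangle_ineq4[of f ?g] by simp
    moreover have "\<bar>blinfun_apply m (f - ?g)\<bar> \<le> e * norm (f - ?g)"
      using n(2) by (intro A(2)) (simp add: ap)
    ultimately have "\<bar>blinfun_apply m (f - ?g)\<bar> \<le> e * C"
      using \<open>e > 0\<close> by (meson less_imp_le mult_left_mono order_trans)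
    moreover have "blinfun_apply m ?g = 0"
      using n(1) by (rule null) (simp add: ap)
    ultimately show ?thesis by (simp add: blinfun.diff_right)
  qed
  have "\<bar>blinfun_apply m f\<bar> \<le> 0"
  proof (rule field_le_epsilon)
    fix e :: real
    assume "e > 0"
    have "C \<ge> 0" unfolding C_def by simp
    then have "\<bar>blinfun_apply m f\<bar> \<le> e / (C + 1) * C"
      using \<open>e > 0\<close> by (intro le) simp
    also have "\<dots> \<le> e"
      using \<open>C \<ge> 0\<close> \<open>e > 0\<close> by (simp add: field_simps)
    finally show "\<bar>blinfun_apply m f\<bar> \<le> 0 + e" by simp
  qed
  then show ?thesis by simp
qed

section \<open>The intersection formula\<close>

lemma INT_free_space_on_apply_eq_0:
  fixes K :: "'i \<Rightarrow> 'a::{pointed_metric_space, complete_space} set"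
  assumes closed: "\<And>i. i \<in> I \<Longrightarrow> closed (K i)"
    and m: "m \<in> free_space" and mK: "\<And>i. i \<in> I \<Longrightarrow> m \<in> free_space_on (K i)"
    and f: "\<And>x. x \<in> (\<Inter>i\<in>I. K i) \<Longrightarrow> lip0_apply f x = 0"
  shows "blinfun_apply m f = 0"
  using m
proof (rule free_space_apply_eq_0_of_clip)
  fix n :: real and g
  assume n: "n > 0" and g: "\<And>x. lip0_apply g x = clip n (lip0_apply f x)"
  show "blinfun_apply m g = 0"
  proof (rule ccontr)
    assume ne: "blinfun_apply m g \<noteq> 0"
    have "\<bar>lip0_apply g x\<bar> \<le> n" for x
      using n by (simp add: g clip_bounded)
    from free_space_concentration_point[OF m this ne] obtain x where
      x: "\<And>e. e > 0 \<Longrightarrow> \<exists>g'. blinfun_apply m g' \<noteq> 0 \<and>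
        {y. lip0_apply g' y \<noteq> 0} \<subseteq> {y. lip0_apply g y \<noteq> 0} \<inter> ball x e"
      by blast
    \<comment> \<open>Closedness of \<open>K i\<close> gives a ball around an outside point that
      misses \<open>K i\<close>. Functions supported in it vanish on \<open>K i\<close>, so
      \<open>m\<close> annihilates them, against concentration at \<open>x\<close>.\<close>
    have "x \<in> K i" if i: "i \<in> I" for i
    proof (rule ccontr)
      assume "x \<notin> K i"
      then obtain e where e: "e > 0" "ball x e \<subseteq> - K i"
        using closed[OF i] by (metis Compl_iff open_Compl open_contains_ball)
      obtain g' where g': "blinfun_apply m g' \<noteq> 0" "{y. lip0_apply g' y \<noteq> 0} \<subseteq> ball x e"
        using x[OF e(1)] by blast
      have "blinfun_apply m g' = 0"
        using mK[OF i] by (rule free_space_on_apply_eq_0) (use g'(2) e(2) in blast)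
      with g'(1) show False by simp
    qed
    then have "lip0_apply f x = 0" using f by simp
    \<comment> \<open>The flat part of \<open>clip n\<close> around 0 acts here: \<open>f\<close> is
      small near \<open>x\<close>, so \<open>g\<close> vanishes on a whole ball and leaves no room
      for a nonzero \<open>g'\<close>.\<close>
    have "continuous_on UNIV (lip0_apply f)"
      using lip0_lipschitz_norm by (rule lipschitz_on_continuous_on)
    then have "open {y. \<bar>lip0_apply f y\<bar> < 1 / (2 * n)}"
      by (intro open_Collect_less continuous_intros)
    moreover have "x \<in> {y. \<bar>lip0_apply f y\<bar> < 1 / (2 * n)}"
      using n \<open>lip0_apply f x = 0\<close> by simp
    ultimately obtain e where e: "e > 0" "ball x e \<subseteq> {y. \<bar>lip0_apply f y\<bar> < 1 / (2 * n)}"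
      using open_contains_ball by blast
    obtain g' where g': "blinfun_apply m g' \<noteq> 0"
      "{y. lip0_apply g' y \<noteq> 0} \<subseteq> {y. lip0_apply g y \<noteq> 0} \<inter> ball x e"
      using x[OF e(1)] by blast
    have "lip0_apply g y = 0" if "y \<in> ball x e" for y
      unfolding g using e(2) that n by (intro clip_eq_0) auto
    with g'(2) have "lip0_apply g' y = 0" for y by blast
    then have "g' = 0" by (intro lip0_eqI) simp
    with g'(1) show False by simp
  qed
qed

theorem theorem2p1:
  fixes K :: "'i \<Rightarrow> 'a::{pointed_metric_space, complete_space} set"
    and I :: "'i set"
  assumes closed_K: "\<And>i. i \<in> I \<Longrightarrow> closed (K i)"
  shows "free_space \<inter> (\<Inter>i\<in>I. free_space_on (K i)) = free_space_on (\<Inter>i\<in>I. K i)"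
proof
  show "free_space \<inter> (\<Inter>i\<in>I. free_space_on (K i)) \<subseteq> free_space_on (\<Inter>i\<in>I. K i)"
  proof
    fix m
    assume m: "m \<in> free_space \<inter> (\<Inter>i\<in>I. free_space_on (K i))"
    then have "m \<in> free_space" by blast
    then show "m \<in> free_space_on (\<Inter>i\<in>I. K i)"
    proof (rule free_space_on_bipolar)
      fix f
      assume "\<And>x. x \<in> (\<Inter>i\<in>I. K i) \<Longrightarrow> lip0_apply f x = 0"
      then show "blinfun_apply m f = 0"
        using closed_K m by (intro INT_free_space_on_apply_eq_0[of I K m f]) auto
    qed
  qed
  show "free_space_on (\<Inter>i\<in>I. K i) \<subseteq> free_space \<inter> (\<Inter>i\<in>I. free_space_on (K i))"
    using free_space_on_subset by (auto dest: subsetD[OF free_space_on_mono, rotated])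
qed

end
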